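(* For every $\varphi\in\Phi$ there exists a constant $C_5(\varphi)\in(0,\infty)$ such that for every $n$ (the degree of the polynomials), $$C_5(\varphi)\, n^2 \;\le\; W(\varphi;n)\;\le\; n^2\cdot K(4)\cdot \max(1,\psi(4))\cdot C_4(\varphi)\cdot C_3(\varphi),$$ where $$W(\varphi;n)=\sup_{Q}\frac{\|dQ/dx\|_{B(\varphi)}}{\|Q\|_{B(\varphi)}},$$ the supremum being over all algebraic polynomials $Q\ne 0$ on $[-1,1]$ with $\deg Q=n$.
   Context: Let $X=[-1,1]$ be equipped with normalized Lebesgue measure $d\mu=\frac12dx$ (so $\mu(X)=1$), and let $I(f)=\int_X f\,d\mu$. The class $\Phi$: the set of all continuous functions $\varphi:[0,\infty)\to[0,\infty)$ such that $\varphi(z)=0\Leftrightarrow z=0$, the function $h(y):=\varphi(e^y)$, $y\in[-\infty,\infty)$ (with $h(-\infty)=\varphi(0)=0$), is strictly increasing and convex, and $\sum_{k\ge 3}\exp(h(k)-h(k+1))<\infty$ (sum over integers). An $N$-Orlicz function is an even, continuous, convex function $N:\mathbb R\to[0,\infty)$ with $N(u)=0\Leftrightarrow u=0$, strictly increasing on $[0,\infty)$. Given $\varphi\in\Phi$, constants $C_1=C_1(\varphi),C_2=C_2(\varphi)\in(0,\infty)$ are fixed such that $$N(\varphi;u)=C_2|u|\ \text{ for }|u|\le C_1,\qquad N(\varphi;u)=\exp\varphi(|u|)\ \text{ for }|u|>C_1$$ defines an $N$-Orlicz function (such constants exist). The norm of a measurable $f:X\to\mathbb R$ is $$\|f\|_{B(\varphi)}=\inf\{l>0:\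 I(N(\varphi;|f|/l))\le 1\}.$$ Further notation: $h^*(p)=\sup_{y\in\mathbb R}(py-h(y))$ is the Young–Fenchel (Legendre) transform, $\psi(p)=\psi(\varphi;p)=\exp(h^*(p)/p)$, and $(h^* )'_+(1)$ is the right derivative of $h^*$ at $1$. Put $$K(4)=(49\pi)^{1/4},\qquad C_3(\varphi)=\max(1,C_1,1/C_2),\qquad k_0=\max\{4+\max(\log C_1,1),\,(h^* )'_+(1)\},$$ $$C_4(\varphi)=e^2\Big[N(\varphi;\exp(k_0-2))+\sum_{k=k_0,k_0+1,k_0+2,\dots}\exp(h(k-1)-h(k))\Big].$$ *)

theory Defs
  imports "HOL-Analysis.Analysis" "HOL-Computational_Algebra.Polynomial"
begin

definition mu :: "real measure" where
  "mu = scale_measure (1 / 2) (lebesgue_on {-1..1})"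

definition h_fun :: "(real \<Rightarrow> real) \<Rightarrow> real \<Rightarrow> real" where
  "h_fun \<phi> y = \<phi> (exp y)"

text \<open>A function on \<open>[0, \<infinity>)\<close> is represented by a function on the reals of which only the
  values on \<open>{0..}\<close> matter.  The function \<open>h\<close> is considered on the reals; its
  extension by \<open>h (-\<infinity>) = \<phi> 0 = 0\<close> adds no condition, since
  \<open>h y > 0\<close> for real \<open>y\<close> follows from the first conjuncts, and convexity
  inequalities with an endpoint at \<open>-\<infinity>\<close> have left-hand side \<open>h (-\<infinity>) = 0\<close>.\<close>

definition class_Phi :: "(real \<Rightarrow> real) set" where
  "class_Phi = {\<phi>.
     continuous_on {0..} \<phi> \<and>
     (\<forall>z\<ge>0. \<phi> z \<ge> 0) \<and>
     (\<forall>z\<ge>0. \<phi> z = 0 \<longleftrightarrow> z = 0) \<and>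
     strict_mono (h_fun \<phi>) \<and>
     convex_on UNIV (h_fun \<phi>) \<and>
     summable (\<lambda>j::nat. exp (h_fun \<phi> (real (j + 3)) - h_fun \<phi> (real (j + 3) + 1)))}"

definition N_Orlicz_function :: "(real \<Rightarrow> real) \<Rightarrow> bool" where
  "N_Orlicz_function N \<longleftrightarrow>
     (\<forall>u. N (- u) = N u) \<and>
     continuous_on UNIV N \<and>
     convex_on UNIV N \<and>
     (\<forall>u. N u \<ge> 0) \<and>
     (\<forall>u. N u = 0 \<longleftrightarrow> u = 0) \<and>
     strict_mono_on {0..} N"

definition N_fun :: "(real \<Rightarrow> real) \<Rightarrow> real \<Rightarrow> real \<Rightarrow> real \<Rightarrow> real" where
  "N_fun \<phi> C1 C2 u = (if \<bar>u\<bar> \<le> C1 then C2 * \<bar>u\<bar> else exp (\<phi> \<bar>u\<bar>))"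

definition admissible_constants :: "(real \<Rightarrow> real) \<Rightarrow> real \<Rightarrow> real \<Rightarrow> bool" where
  "admissible_constants \<phi> C1 C2 \<longleftrightarrow> C1 > 0 \<and> C2 > 0 \<and> N_Orlicz_function (N_fun \<phi> C1 C2)"

text \<open>The norm takes values in \<open>ennreal\<close>, so that it is \<open>\<infinity>\<close> when no \<open>l\<close> qualifies.\<close>

definition B_norm :: "(real \<Rightarrow> real) \<Rightarrow> real \<Rightarrow> real \<Rightarrow> (real \<Rightarrow> real) \<Rightarrow> ennreal" where
  "B_norm \<phi> C1 C2 f =
     (INF l \<in> {l::real. l > 0 \<and> (\<integral>\<^sup>+ x. ennreal (N_fun \<phi> C1 C2 (\<bar>f x\<bar> / l)) \<partial>mu) \<le> 1}. ennreal l)"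

text \<open>The supremum is taken in the reals.  For \<open>\<phi>\<close> in the class above it is finite for
  every \<open>p \<ge> 0\<close>: summability forces the increments of \<open>h\<close> to infinity,
  so \<open>h\<close> grows faster than linearly. Only \<open>p = 4\<close> and \<open>p\<close> in a right
  neighbourhood of 1 are used.\<close>

definition h_star :: "(real \<Rightarrow> real) \<Rightarrow> real \<Rightarrow> real" where
  "h_star \<phi> p = (SUP y. p * y - h_fun \<phi> y)"

definition psi :: "(real \<Rightarrow> real) \<Rightarrow> real \<Rightarrow> real" where
  "psi \<phi> p = exp (h_star \<phi> p / p)"

definition right_deriv :: "(real \<Rightarrow> real) \<Rightarrow> real \<Rightarrow> real" where
  "right_deriv g x = vector_derivative g (at_right x)"

definition K4 :: real where
  "K4 = (49 * pi) powr (1 / 4)"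

definition C3 :: "real \<Rightarrow> real \<Rightarrow> real" where
  "C3 C1 C2 = max 1 (max C1 (1 / C2))"

definition k0 :: "(real \<Rightarrow> real) \<Rightarrow> real \<Rightarrow> real" where
  "k0 \<phi> C1 = max (4 + max (ln C1) 1) (right_deriv (h_star \<phi>) 1)"

text \<open>\<open>k0\<close> need not be an integer; the series runs over \<open>k0, k0 + 1, k0 + 2, \<dots>\<close>.\<close>

definition C4 :: "(real \<Rightarrow> real) \<Rightarrow> real \<Rightarrow> real \<Rightarrow> real" where
  "C4 \<phi> C1 C2 = exp 2 *
     (N_fun \<phi> C1 C2 (exp (k0 \<phi> C1 - 2)) +
      (\<Sum>j::nat. exp (h_fun \<phi> (k0 \<phi> C1 + real j - 1) - h_fun \<phi> (k0 \<phi> C1 + real j))))"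

definition W :: "(real \<Rightarrow> real) \<Rightarrow> real \<Rightarrow> real \<Rightarrow> nat \<Rightarrow> ennreal" where
  "W \<phi> C1 C2 n =
     (SUP Q \<in> {Q::real poly. Q \<noteq> 0 \<and> degree Q = n}.
        B_norm \<phi> C1 C2 (poly (pderiv Q)) / B_norm \<phi> C1 C2 (poly Q))"

end

theory Submission
  imports Defs
begin

text \<open>For polynomials \<open>P\<close> of degree at most \<open>n\<close>, interpolation at the Chebyshev nodes
  \<open>y\<^sub>k\<close> gives \<open>P'(1) = \<Sum>\<^sub>k c\<^sub>k P(y\<^sub>k)\<close> with \<open>\<Sum>\<^sub>k \<bar>c\<^sub>k\<bar> = n\<^sup>2\<close>.  Applying this to
  \<open>P(y) = Q(x - (1 - y) / 2)\<close> for \<open>x \<in> [0, 1]\<close> represents \<open>Q'(x)\<close> by values of \<open>Q\<close> at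
  translates of \<open>x\<close> inside \<open>[-1, 1]\<close>, and Jensen's inequality yields the Markov inequality with
  constant \<open>4 n\<^sup>2\<close> in the norm of every even convex \<open>N\<close>.  The constant of the theorem is
  larger, since \<open>C4 \<ge> e\<^sup>2 N(exp (k0 - 2)) \<ge> e\<^sup>2\<close> and the other factors are at least 1.

  For the lower bound, a polynomial bounded by \<open>Q(1) = 1\<close> with integral \<open>O(n\<^sup>-\<^sup>2)\<close> that drops to
  1/2 at distance \<open>O(n\<^sup>-\<^sup>2)\<close> from 1 has \<open>N(n\<^sup>2 / l) = O(n\<^sup>2)\<close> for every \<open>l\<close> admissible in the norm
  of \<open>Q'\<close>; since \<open>N(t u) \<le> t N(u)\<close> for \<open>t \<le> 1\<close>, a multiple of \<open>l / n\<^sup>2\<close> is then admissible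
  for \<open>Q\<close>.\<close>

subsection \<open>Chebyshev polynomials\<close>

text \<open>\<open>chebT k\<close> is \<open>T\<^sub>k\<close> and \<open>chebS k\<close> is \<open>U\<^sub>k\<^sub>-\<^sub>1\<close>; the recursion is that of
  \<open>cos ((k + 1) t)\<close> and \<open>sin ((k + 1) t) / sin t\<close>.\<close>

fun chebT :: "nat \<Rightarrow> real poly" and chebS :: "nat \<Rightarrow> real poly" where
  "chebT 0 = 1"
| "chebT (Suc k) = pCons 0 (chebT k) - chebS k + pCons 0 (pCons 0 (chebS k))"
| "chebS 0 = 0"
| "chebS (Suc k) = pCons 0 (chebS k) + chebT k"

lemma poly_chebT_Suc:
  "poly (chebT (Suc k)) x = x * poly (chebT k) x - (1 - x\<^sup>2) * poly (chebS k) x"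
  by (simp add: algebra_simps power2_eq_square)

lemma poly_chebS_Suc: "poly (chebS (Suc k)) x = x * poly (chebS k) x + poly (chebT k) x"
  by simp

lemma chebT_cos: "poly (chebT k) (cos t) = cos (real k * t)"
  and chebS_cos: "poly (chebS k) (cos t) * sin t = sin (real k * t)"
proof (induction k)
  case (Suc k)
  have s: "1 - (cos t)\<^sup>2 = sin t * sin t"
    by (simp add: sin_squared_eq flip: power2_eq_square)
  have a: "real (Suc k) * t = t + real k * t"
    by (simp add: algebra_simps)
  {
    case 1
    show ?case
      using Suc by (simp only: poly_chebT_Suc s a cos_add) (metis mult.assoc mult.commute)
  next
    case 2
    show ?case
      using Suc by (simp only: poly_chebS_Suc a sin_add) (simp add: algebra_simps)
  }
qed auto

text \<open>The left side is the norm of T + S sqrt(x^2 - 1), and each step of the recursion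
  multiplies by x + sqrt(x^2 - 1), whose norm is 1. Both the bounds on [-1, 1] and the decay of the
  peaked kernel come from this identity.\<close>

lemma cheb_pell: "(poly (chebT k) x)\<^sup>2 + (1 - x\<^sup>2) * (poly (chebS k) x)\<^sup>2 = 1"
proof (induction k)
  case (Suc k)
  have "(x * T - (1 - x\<^sup>2) * S)\<^sup>2 + (1 - x\<^sup>2) * (x * S + T)\<^sup>2 = T\<^sup>2 + (1 - x\<^sup>2) * S\<^sup>2" for T S :: real
    by (simp add: power2_eq_square algebra_simps)
  then show ?case
    using Suc by (simp only: poly_chebT_Suc poly_chebS_Suc)
qed auto

lemma abs_chebT_le:
  assumes "\<bar>x\<bar> \<le> 1"
  shows "\<bar>poly (chebT k) x\<bar> \<le> 1"
proof -
  have "x\<^sup>2 \<le> 1"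
    using assms by (simp add: abs_square_le_1)
  then have "0 \<le> (1 - x\<^sup>2) * (poly (chebS k) x)\<^sup>2"
    by simp
  then have "(poly (chebT k) x)\<^sup>2 \<le> 1"
    using cheb_pell[of k x] by linarith
  then show ?thesis
    by (simp add: abs_square_le_1)
qed

lemma abs_chebS_le:
  assumes "\<bar>x\<bar> \<le> 1"
  shows "\<bar>poly (chebS k) x\<bar> \<le> real k"
proof (induction k)
  case (Suc k)
  have "\<bar>x * poly (chebS k) x\<bar> \<le> 1 * real k"
    unfolding abs_mult using assms Suc by (intro mult_mono) auto
  with abs_chebT_le[OF assms, of k] show ?case
    unfolding poly_chebS_Suc of_nat_Suc by linarith
qed auto

lemma chebT_at_1 [simp]: "poly (chebT k) 1 = 1"
  by (induction k) auto

lemma chebS_at_1 [simp]: "poly (chebS k) 1 = real k"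
  by (induction k) auto

lemma pderiv_chebT_at_1: "poly (pderiv (chebT k)) 1 = (real k)\<^sup>2"
  by (induction k) (auto simp: pderiv_pCons pderiv_add pderiv_diff power2_eq_square algebra_simps)

lemma coeff_chebT_eq_0: "k < i \<Longrightarrow> poly.coeff (chebT k) i = 0"
  and coeff_chebS_eq_0: "k \<le> i \<Longrightarrow> poly.coeff (chebS k) i = 0"
  by (induction k arbitrary: i) (auto simp: coeff_pCons split: nat.splits)

text \<open>In the recursion the leading terms add with positive sign, so no cancellation lowers the
  degree.\<close>

lemma coeff_chebT_pos: "poly.coeff (chebT k) k > 0"
  and coeff_chebS_pos: "poly.coeff (chebS (Suc k)) k > 0"
proof (induction k)
  case (Suc k)
  { case 1 show ?case using Suc by (auto simp: coeff_chebS_eq_0) }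
  { case 2 show ?case using Suc by (auto simp: coeff_chebS_eq_0) }
qed auto

lemma degree_chebT: "degree (chebT k) = k"
  by (intro antisym degree_le le_degree) (use coeff_chebT_pos[of k] in \<open>auto simp: coeff_chebT_eq_0\<close>)

lemma degree_chebS: "degree (chebS (Suc k)) = k"
  by (intro antisym degree_le le_degree)
    (use coeff_chebS_pos[of k] in \<open>auto simp: coeff_chebS_eq_0 simp del: chebS.simps\<close>)

subsection \<open>Differentiation by interpolation\<close>

text \<open>A polynomial of degree at most \<open>n\<close> is its own Lagrange interpolant at
  \<open>n + 1\<close> distinct nodes; \<open>c k\<close> is the derivative at \<open>x\<close> of
  the Lagrange basis polynomial belonging to \<open>y k\<close>.\<close>

lemma interpolation_derivative:
  fixes y :: "nat \<Rightarrow> real" and x :: real and P :: "real poly"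
  assumes inj: "inj_on y {..n}"
  defines "c \<equiv> \<lambda>k. poly (pderiv (\<Prod>j\<in>{..n}-{k}. [:- y j, 1:])) x / (\<Prod>j\<in>{..n}-{k}. y k - y j)"
  assumes P: "degree P \<le> n"
  shows "poly (pderiv P) x = (\<Sum>k\<le>n. c k * poly P (y k))"
proof -
  define L where "L = (\<lambda>k. \<Prod>j\<in>{..n}-{k}. [:- y j, 1:])"
  define d where "d = (\<lambda>k. \<Prod>j\<in>{..n}-{k}. y k - y j)"
  have d0: "d k \<noteq> 0" if "k \<le> n" for k
    using that inj by (auto simp: d_def inj_on_def)
  have polyL: "poly (L k) (y i) = (if i = k then d k else 0)" if "i \<le> n" "k \<le> n" for i k
    using that by (auto simp: L_def d_def poly_prod)
  define R where "R = (\<Sum>k\<le>n. smult (poly P (y k) / d k) (L k))"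
  have "degree (L k) \<le> n" if "k \<le> n" for k
  proof -
    have "degree (L k) \<le> (\<Sum>j\<in>{..n}-{k}. 1)"
      unfolding L_def by (rule order_trans[OF degree_prod_sum_le]) (auto simp: o_def)
    then show ?thesis using that by simp
  qed
  then have R: "degree R \<le> n"
    unfolding R_def by (intro degree_sum_le) (auto intro: order_trans[OF degree_smult_le])
  have "P = R"
  proof (rule poly_eqI_degree[of "y ` {..n}"])
    fix t assume "t \<in> y ` {..n}"
    then obtain i where i: "i \<le> n" "t = y i" by auto
    have "poly R t = (\<Sum>k\<le>n. if k = i then poly P (y k) else 0)"
      unfolding R_def poly_sum by (intro sum.cong) (use i d0 polyL in auto)
    also have "\<dots> = poly P t"
      using i by simp
    finally show "poly P t = poly R t" ..
  qed (use P R inj in \<open>auto simp: card_image\<close>)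
  then have "poly (pderiv P) x = poly (pderiv R) x"
    by simp
  also have "\<dots> = (\<Sum>k\<le>n. c k * poly P (y k))"
    unfolding R_def
    by (simp add: higher_pderiv_sum[of 1, simplified] pderiv_smult poly_sum c_def L_def d_def mult.commute)
  finally show ?thesis .
qed

text \<open>For the Chebyshev nodes the weights alternate in sign, so that the sum of their
  absolute values is attained at the Chebyshev polynomial.\<close>

lemma markov_functional:
  assumes "n > 0"
  obtains y c :: "nat \<Rightarrow> real"
  where "\<And>k. \<bar>y k\<bar> \<le> 1" "(\<Sum>k\<le>n. \<bar>c k\<bar>) = (real n)\<^sup>2"
    "\<And>P. degree P \<le> n \<Longrightarrow> poly (pderiv P) 1 = (\<Sum>k\<le>n. c k * poly P (y k))"
proof -
  \<comment> \<open>The extremal points of \<open>chebT n\<close>, decreasing from 1 to -1;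
    \<open>chebT n\<close> takes the value (-1)^k at \<open>y k\<close>.\<close>
  define y where "y = (\<lambda>k::nat. cos (real k * pi / real n))"
  have y_less: "y j < y i" if "i < j" "j \<le> n" for i j
    unfolding y_def using that assms
    by (intro cos_monotone_0_pi) (auto simp: field_simps intro!: mult_left_mono)
  then have inj: "inj_on y {..n}"
    by (auto simp: inj_on_def) (metis less_irrefl linorder_neqE_nat)
  define c where "c = (\<lambda>k. poly (pderiv (\<Prod>j\<in>{..n}-{k}. [:- y j, 1:])) 1 / (\<Prod>j\<in>{..n}-{k}. y k - y j))"
  have repr: "poly (pderiv P) 1 = (\<Sum>k\<le>n. c k * poly P (y k))" if "degree P \<le> n" for P
    unfolding c_def by (rule interpolation_derivative[OF inj that])
  have sign: "\<bar>c k\<bar> = c k * (-1) ^ k" if k: "k \<le> n" for k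
  proof -
    \<comment> \<open>All factors X - y_j are nonnegative at 1, hence so is every term of the
      product rule.\<close>
    have num: "0 \<le> poly (pderiv (\<Prod>j\<in>{..n}-{k}. [:- y j, 1:])) 1"
      by (auto simp: pderiv_prod poly_sum poly_prod pderiv_pCons y_def intro!: sum_nonneg prod_nonneg)
    \<comment> \<open>The \<open>k\<close> nodes of smaller index lie to the right of
      \<open>y k\<close> and produce the sign (-1)^k.\<close>
    have "{..n} - {k} = {..<k} \<union> {k<..n}"
      using k by auto
    then have "(\<Prod>j\<in>{..n}-{k}. y k - y j) = (\<Prod>j<k. y k - y j) * (\<Prod>j\<in>{k<..n}. y k - y j)"
      by (simp add: prod.union_disjoint disjoint_iff)
    also have "(\<Prod>j<k. y k - y j) = (\<Prod>j<k. (-1) * (y j - y k))"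
      by simp
    also have "\<dots> = (-1) ^ k * (\<Prod>j<k. y j - y k)"
      unfolding prod.distrib by simp
    finally have den: "(\<Prod>j\<in>{..n}-{k}. y k - y j) = (-1) ^ k * ((\<Prod>j<k. y j - y k) * (\<Prod>j\<in>{k<..n}. y k - y j))"
      by simp
    have "0 \<le> (\<Prod>j<k. y j - y k) * (\<Prod>j\<in>{k<..n}. y k - y j)"
      using y_less k by (intro mult_nonneg_nonneg prod_nonneg) (auto intro: less_imp_le)
    moreover have "\<bar>u / ((-1) ^ k * v)\<bar> = u / ((-1) ^ k * v) * (-1) ^ k" if "0 \<le> u" "0 \<le> v" for u v :: real
      using that by (cases "even k") auto
    ultimately show ?thesis
      unfolding c_def den using num by blast
  qed
  have "(\<Sum>k\<le>n. \<bar>c k\<bar>) = (\<Sum>k\<le>n. c k * poly (chebT n) (y k))"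
    using assms by (intro sum.cong) (auto simp: sign y_def chebT_cos cos_npi)
  also have "\<dots> = (real n)\<^sup>2"
    using repr[of "chebT n"] by (simp add: degree_chebT pderiv_chebT_at_1)
  finally have "(\<Sum>k\<le>n. \<bar>c k\<bar>) = (real n)\<^sup>2" .
  then show thesis
    using repr by (intro that[of y c]) (auto simp: y_def)
qed

subsection \<open>Modular inequalities for even convex functions\<close>

locale even_convex =
  fixes N :: "real \<Rightarrow> real"
  assumes even: "N (- u) = N u"
    and cont: "continuous_on UNIV N"
    and conv: "convex_on UNIV N"
    and nonneg: "N u \<ge> 0"
    and zero: "N 0 = 0"
begin

lemma continuous_on_N [continuous_intros]:
  "continuous_on A f \<Longrightarrow> continuous_on A (\<lambda>x. N (f x))"
  by (rule continuous_on_compose2[OF cont]) auto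

lemma N_abs: "N \<bar>u\<bar> = N u"
  by (simp add: abs_if even)

lemma N_scale_le:
  assumes "0 \<le> t" "t \<le> 1"
  shows "N (t * u) \<le> t * N u"
  using convex_onD[OF conv assms, of 0 u] by (simp add: zero)

lemma N_mult_le:
  assumes "\<bar>t\<bar> \<le> 1"
  shows "N (t * u) \<le> \<bar>t\<bar> * N u"
  using N_scale_le[of "\<bar>t\<bar>" "\<bar>u\<bar>"] N_abs[of "t * u"] N_abs[of u] assms by (simp add: abs_mult)

lemma N_mono:
  assumes "\<bar>u\<bar> \<le> \<bar>v\<bar>"
  shows "N u \<le> N v"
proof (cases "v = 0")
  case False
  have "N ((u / v) * v) \<le> \<bar>u / v\<bar> * N v"
    using assms False by (intro N_mult_le) (simp add: field_simps)
  also have "\<dots> \<le> 1 * N v"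
    using assms False nonneg by (intro mult_right_mono) (simp_all add: field_simps)
  finally show ?thesis
    using False by simp
qed (use assms in auto)

text \<open>Up to \<open>u\<close> the right side is nonpositive, and beyond \<open>u\<close> the
  quotient N(v)/v is at least N(u)/u. An affine minorant of \<open>N\<close> can be integrated
  exactly along a derivative.\<close>

lemma N_ge_linear:
  assumes "u > 0"
  shows "N v \<ge> N u / u * (v - u)"
proof (cases "v \<le> u")
  case True
  then have "N u / u * (v - u) \<le> 0"
    using assms nonneg[of u] by (intro mult_nonneg_nonpos) auto
  then show ?thesis
    using nonneg[of v] by linarith
next
  case False
  have "N ((u / v) * v) \<le> u / v * N v"
    using assms False by (intro N_scale_le) auto
  then have "N u / u * v \<le> N v"
    using assms False by (simp add: field_simps)
  moreover have "N u / u * (v - u) \<le> N u / u * v"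
    using assms nonneg[of u] by (intro mult_left_mono) auto
  ultimately show ?thesis
    by linarith
qed

text \<open>The functional at the end point 1 is transported to \<open>x\<close> by the affine map taking
  \<open>[-1, 1]\<close> onto \<open>[x - 1, x]\<close>.  Its nodes become translates of \<open>x\<close>, so after Jensen's
  inequality the integral over \<open>x\<close> sees only translations of \<open>Q\<close>.\<close>

lemma markov_modular_half:
  assumes n: "n > 0" and deg: "degree Q \<le> n"
  shows "integral {0..1} (\<lambda>x. N (poly (pderiv Q) x / (2 * (real n)\<^sup>2)))
           \<le> integral {-1..1} (\<lambda>x. N (poly Q x))"
proof -
  obtain y c :: "nat \<Rightarrow> real" where y: "\<And>k. \<bar>y k\<bar> \<le> 1"
    and c: "(\<Sum>k\<le>n. \<bar>c k\<bar>) = (real n)\<^sup>2"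
    and repr: "\<And>P. degree P \<le> n \<Longrightarrow> poly (pderiv P) 1 = (\<Sum>k\<le>n. c k * poly P (y k))"
    by (rule markov_functional[OF n]) (rule that)
  define w where "w = (\<lambda>k. \<bar>c k\<bar> / (real n)\<^sup>2)"
  define s where "s = (\<lambda>k. (1 - y k) / 2)"
  have s: "0 \<le> s k" "s k \<le> 1" for k
    using y[of k] by (auto simp: s_def)
  have w: "(\<Sum>k\<le>n. w k) = 1" "\<And>k. 0 \<le> w k"
    using c n by (auto simp: w_def simp flip: sum_divide_distrib)
  have jensen: "N (poly (pderiv Q) x / (2 * (real n)\<^sup>2)) \<le> (\<Sum>k\<le>n. w k * N (poly Q (x - s k)))" for x
  proof -
    \<comment> \<open>The affine substitution has slope 1/2, which puts the factor 2 into the scale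
      2 n^2.\<close>
    have "poly (pderiv Q) x / 2 = poly (pderiv (pcompose Q [:x - 1/2, 1/2:])) 1"
      by (simp add: pderiv_pcompose poly_pcompose pderiv_pCons)
    also have "\<dots> = (\<Sum>k\<le>n. c k * poly (pcompose Q [:x - 1/2, 1/2:]) (y k))"
      by (rule repr) (use deg in \<open>simp add: degree_pcompose\<close>)
    also have "\<dots> = (\<Sum>k\<le>n. c k * poly Q (x - s k))"
      by (simp add: poly_pcompose s_def field_simps)
    finally have "poly (pderiv Q) x / (2 * (real n)\<^sup>2) = (\<Sum>k\<le>n. c k * poly Q (x - s k)) / (real n)\<^sup>2"
      by (simp add: field_simps)
    \<comment> \<open>The signs of the weights move into the argument, where evenness of
      \<open>N\<close> removes them after Jensen.\<close>
    also have "\<dots> = (\<Sum>k\<le>n. w k *\<^sub>R (sgn (c k) * poly Q (x - s k)))"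
      unfolding sum_divide_distrib by (intro sum.cong) (auto simp: w_def sgn_if)
    finally have "N (poly (pderiv Q) x / (2 * (real n)\<^sup>2))
        = N (\<Sum>k\<le>n. w k *\<^sub>R (sgn (c k) * poly Q (x - s k)))"
      by simp
    also have "\<dots> \<le> (\<Sum>k\<le>n. w k * N (sgn (c k) * poly Q (x - s k)))"
      by (rule convex_on_sum[OF _ _ conv]) (use w in auto)
    also have "\<dots> = (\<Sum>k\<le>n. w k * N (poly Q (x - s k)))"
      by (intro sum.cong) (auto simp: sgn_if even w_def)
    finally show ?thesis .
  qed
  \<comment> \<open>Since \<open>s k\<close> lies in [0, 1], the translate of [0, 1] stays inside
    [-1, 1].\<close>
  have shift: "integral {0..1} (\<lambda>x. N (poly Q (x - s k))) \<le> integral {-1..1} (\<lambda>x. N (poly Q x))" for k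
  proof -
    have "integral {0..1} (\<lambda>x. N (poly Q (x - s k))) = integral {- s k..1 - s k} (\<lambda>x. N (poly Q x))"
      using integral_shift_real_ivl[of "- s k" "- s k" "1 - s k" "\<lambda>x. N (poly Q x)"] by simp
    also have "\<dots> \<le> integral {-1..1} (\<lambda>x. N (poly Q x))"
      using s[of k] nonneg
      by (intro integral_subset_le integrable_continuous_interval continuous_intros) auto
    finally show ?thesis .
  qed
  have "integral {0..1} (\<lambda>x. N (poly (pderiv Q) x / (2 * (real n)\<^sup>2)))
      \<le> integral {0..1} (\<lambda>x. \<Sum>k\<le>n. w k * N (poly Q (x - s k)))"
    using jensen n by (intro integral_le integrable_continuous_interval continuous_intros) auto
  also have "\<dots> = (\<Sum>k\<le>n. integral {0..1} (\<lambda>x. w k * N (poly Q (x - s k))))"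
    by (intro integral_sum integrable_continuous_interval continuous_intros) auto
  also have "\<dots> = (\<Sum>k\<le>n. w k * integral {0..1} (\<lambda>x. N (poly Q (x - s k))))"
    by simp
  also have "\<dots> \<le> (\<Sum>k\<le>n. w k * integral {-1..1} (\<lambda>x. N (poly Q x)))"
    by (intro sum_mono mult_left_mono shift w)
  also have "\<dots> = integral {-1..1} (\<lambda>x. N (poly Q x))"
    using w by (simp flip: sum_distrib_right)
  finally show ?thesis .
qed

text \<open>The half interval [-1, 0] follows by reflecting \<open>Q\<close>. Adding the two halves
  costs a factor 2 in the modular, which is recovered by halving the argument; hence 4 n^2 in place
  of 2 n^2.\<close>

lemma markov_modular:
  assumes n: "n > 0" and deg: "degree Q \<le> n"
  shows "integral {-1..1} (\<lambda>x. N (poly (pderiv Q) x / (4 * (real n)\<^sup>2)))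
           \<le> integral {-1..1} (\<lambda>x. N (poly Q x))"
proof -
  define G where "G = (\<lambda>x. N (poly (pderiv Q) x / (2 * (real n)\<^sup>2)))"
  define M where "M = integral {-1..1} (\<lambda>x. N (poly Q x))"
  have contG: "continuous_on A G" for A
    unfolding G_def using n by (intro continuous_intros) auto
  have right: "integral {0..1} G \<le> M"
    unfolding G_def M_def by (rule markov_modular_half[OF assms])
  have refl: "poly (pcompose Q [:0, -1:]) x = poly Q (- x)"
    "poly (pderiv (pcompose Q [:0, -1:])) x = - poly (pderiv Q) (- x)" for x
    by (simp_all add: poly_pcompose pderiv_pcompose pderiv_pCons)
  have "integral {-1..0} G = integral {0..1} (\<lambda>x. G (- x))"
    using Henstock_Kurzweil_Integration.integral_reflect_real[where a = 0 and b = 1 and f = "\<lambda>x. G (- x)"] by simp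
  also have "\<dots> \<le> integral {-1..1} (\<lambda>x. N (poly Q (- x)))"
    using markov_modular_half[OF n, of "pcompose Q [:0, -1:]"] deg
    by (simp add: degree_pcompose refl G_def even flip: minus_divide_left)
  also have "\<dots> = M"
    using Henstock_Kurzweil_Integration.integral_reflect_real[where a = "-1" and b = 1 and f = "\<lambda>x. N (poly Q x)"] by (simp add: M_def)
  finally have left: "integral {-1..0} G \<le> M" .
  have "integral {-1..1} (\<lambda>x. N (poly (pderiv Q) x / (4 * (real n)\<^sup>2))) \<le> integral {-1..1} (\<lambda>x. G x / 2)"
  proof (intro integral_le integrable_continuous_interval continuous_intros contG)
    fix x :: real
    show "N (poly (pderiv Q) x / (4 * (real n)\<^sup>2)) \<le> G x / 2"
      using N_scale_le[of "1/2" "poly (pderiv Q) x / (2 * (real n)\<^sup>2)"] by (simp add: G_def)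
  qed (use n in auto)
  also have "\<dots> = (integral {-1..0} G + integral {0..1} G) / 2"
    using Henstock_Kurzweil_Integration.integral_combine[of "-1" 0 1 G] contG by (simp add: integrable_continuous_interval)
  also have "\<dots> \<le> M"
    using left right by simp
  finally show ?thesis
    by (simp add: M_def)
qed

text \<open>If \<open>Q\<close> rises from at most 1/2 to 1 on an interval of length \<open>d\<close>, the mean of \<open>Q'\<close> there
  is at least \<open>1 / (2 d)\<close>.\<close>

lemma N_le_of_steep:
  assumes a: "a \<ge> 1" and d: "1 / a\<^sup>2 \<le> d" "d \<le> 2 / a\<^sup>2" "d \<le> 1" and l: "l > 0"
    and Q: "poly Q 1 = 1" "poly Q (1 - d) \<le> 1/2"
    and le: "integral {-1..1} (\<lambda>x. N (poly (pderiv Q) x / l)) \<le> 2"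
  shows "N (a\<^sup>2 / (8 * l)) \<le> 2 * a\<^sup>2"
proof -
  have d0: "d > 0"
    using d(1) a by (smt (verit) divide_pos_pos zero_less_power)
  \<comment> \<open>Half of the lower bound 1/(2 d l) for the mean of Q'/l on [1 - d, 1], so that
    the mean excess over \<open>u\<close> is still at least \<open>u\<close>.\<close>
  define u where "u = 1 / (4 * d * l)"
  have u: "u > 0"
    using d0 l by (simp add: u_def)
  have 1: "((\<lambda>x. N u / u * (poly (pderiv Q) x / l - u)) has_integral
      (N u / u * (poly Q 1 / l - u * 1) - N u / u * (poly Q (1 - d) / l - u * (1 - d)))) {1 - d..1}"
    using d0 l u by (intro fundamental_theorem_of_calculus)
      (auto intro!: derivative_eq_intros simp flip: has_real_derivative_iff_has_vector_derivative)
  have "u * d \<le> (poly Q 1 - poly Q (1 - d)) / l - u * d"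
  proof -
    have "2 * (u * d) = (1/2) / l"
      using d0 l by (simp add: u_def)
    also have "\<dots> \<le> (poly Q 1 - poly Q (1 - d)) / l"
      using Q l by (intro divide_right_mono) auto
    finally show ?thesis by linarith
  qed
  then have "N u / u * (u * d) \<le> N u / u * ((poly Q 1 - poly Q (1 - d)) / l - u * d)"
    using u nonneg[of u] by (intro mult_left_mono) auto
  also have "\<dots> = integral {1 - d..1} (\<lambda>x. N u / u * (poly (pderiv Q) x / l - u))"
    using integral_unique[OF 1] by (simp add: algebra_simps diff_divide_distrib)
  also have "\<dots> \<le> integral {1 - d..1} (\<lambda>x. N (poly (pderiv Q) x / l))"
    using l by (intro integral_le integrable_continuous_interval continuous_intros N_ge_linear u) auto
  also have "\<dots> \<le> integral {-1..1} (\<lambda>x. N (poly (pderiv Q) x / l))"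
    using d d0 l nonneg
    by (intro integral_subset_le integrable_continuous_interval continuous_intros) auto
  finally have "N u * d \<le> 2"
    using le u by simp
  then have "N u \<le> 2 / d"
    using d0 by (simp add: field_simps)
  also have "\<dots> \<le> 2 * a\<^sup>2"
    using d(1) d0 a by (simp add: field_simps)
  finally have "N u \<le> 2 * a\<^sup>2" .
  moreover have "a\<^sup>2 / (8 * l) \<le> u"
  proof -
    have "a\<^sup>2 * d \<le> 2"
      using d(2) a by (simp add: field_simps)
    then show ?thesis
      using d0 l by (simp add: u_def field_simps)
  qed
  then have "N (a\<^sup>2 / (8 * l)) \<le> N u"
    using l by (intro N_mono) auto
  ultimately show ?thesis by linarith
qed

text \<open>Since |Q| <= 1, the modular is at most N(v) times the integral of |Q|, where v = a^2/(64
  l). The second factor 8 in 64 = 8 * 8 gives N(v) <= a^2/4, and (a^2/4)(8/a^2) = 2.\<close>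

lemma modular_le_of_concentrated:
  assumes a: "a \<ge> 1" and l: "l > 0"
    and N: "N (a\<^sup>2 / (8 * l)) \<le> 2 * a\<^sup>2"
    and Q: "\<And>x. \<bar>x\<bar> \<le> 1 \<Longrightarrow> \<bar>poly Q x\<bar> \<le> 1"
      "integral {-1..1} (\<lambda>x. \<bar>poly Q x\<bar>) \<le> 8 / a\<^sup>2"
  shows "integral {-1..1} (\<lambda>x. N (poly Q x / (64 * l / a\<^sup>2))) \<le> 2"
proof -
  define v where "v = a\<^sup>2 / (64 * l)"
  have "N v \<le> (1/8) * N (a\<^sup>2 / (8 * l))"
    using N_scale_le[of "1/8" "a\<^sup>2 / (8 * l)"] by (simp add: v_def)
  then have v: "N v \<le> a\<^sup>2 / 4"
    using N by linarith
  have "integral {-1..1} (\<lambda>x. N (poly Q x / (64 * l / a\<^sup>2))) \<le> integral {-1..1} (\<lambda>x. \<bar>poly Q x\<bar> * N v)"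
  proof (intro integral_le integrable_continuous_interval continuous_intros)
    fix x :: real assume "x \<in> {-1..1}"
    then have "\<bar>x\<bar> \<le> 1"
      by auto
    then show "N (poly Q x / (64 * l / a\<^sup>2)) \<le> \<bar>poly Q x\<bar> * N v"
      using N_mult_le[of "poly Q x" v] Q(1)[of x] by (simp add: v_def)
  qed (use a l in auto)
  also have "\<dots> = integral {-1..1} (\<lambda>x. \<bar>poly Q x\<bar>) * N v"
    by simp
  also have "\<dots> \<le> 8 / a\<^sup>2 * (a\<^sup>2 / 4)"
    by (intro mult_mono Q v nonneg) simp
  finally show ?thesis
    using a by simp
qed

end

subsection \<open>Peaked polynomials\<close>

lemma integral_inverse_square_le:
  assumes "b > 0"
  shows "(\<lambda>x::real. 4 / (1 + b * (1 - x))\<^sup>2) integrable_on {-1..1}"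
    and "integral {-1..1} (\<lambda>x. 4 / (1 + b * (1 - x))\<^sup>2) \<le> 4 / b"
proof -
  have pos: "1 + b * (1 - x) > 0" if "x \<le> 1" for x :: real
    using mult_nonneg_nonneg[of b "1 - x"] assms that by linarith
  have "((\<lambda>x. 4 / (b * (1 + b * (1 - x)))) has_real_derivative 4 / (1 + b * (1 - x))\<^sup>2) (at x within {-1..1})"
    if "x \<in> {-1..1}" for x
    using assms pos[of x] that
    by (auto intro!: derivative_eq_intros simp: divide_simps power2_eq_square)
  then have "((\<lambda>x. 4 / (1 + b * (1 - x))\<^sup>2) has_integral
      4 / (b * (1 + b * (1 - 1))) - 4 / (b * (1 + b * (1 - (-1))))) {-1..1}"
    by (intro fundamental_theorem_of_calculus) (auto simp flip: has_real_derivative_iff_has_vector_derivative)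
  moreover have "4 / (b * (1 + b * (1 - (-1)))) \<ge> 0"
    using assms by simp
  ultimately show "(\<lambda>x. 4 / (1 + b * (1 - x))\<^sup>2) integrable_on {-1..1}"
    and "integral {-1..1} (\<lambda>x. 4 / (1 + b * (1 - x))\<^sup>2) \<le> 4 / b"
    by (auto simp: has_integral_integrable integral_unique)
qed

text \<open>With u = b(1 - |x|), the two bounds on \<open>f\<close> combine to |f| <= 4/(1 + u)^2,
  and each of the two end points contributes mass at most 4/b.\<close>

lemma integral_abs_le_of_decay:
  assumes b: "b > 0" and cont: "continuous_on {-1..1} f"
    and le: "\<And>x. \<bar>x\<bar> \<le> 1 \<Longrightarrow> \<bar>f x\<bar> \<le> 1"
    and decay: "\<And>x. \<bar>x\<bar> \<le> 1 \<Longrightarrow> \<bar>f x\<bar> * (b * (1 - x\<^sup>2))\<^sup>2 \<le> (1::real)"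
  shows "integral {-1..1} (\<lambda>x. \<bar>f x\<bar>) \<le> 8 / b"
proof -
  define g where "g = (\<lambda>x. 4 / (1 + b * (1 - x))\<^sup>2)"
  have g0: "0 \<le> g x" for x
    by (simp add: g_def)
  have g: "g integrable_on {-1..1}" "integral {-1..1} g \<le> 4 / b"
    using integral_inverse_square_le[OF b] by (simp_all add: g_def)
  have g': "(\<lambda>x. g (- x)) integrable_on {-1..1}" "integral {-1..1} (\<lambda>x. g (- x)) = integral {-1..1} g"
    using g(1) Henstock_Kurzweil_Integration.integrable_reflect_real[where a = "-1" and b = 1 and f = g] Henstock_Kurzweil_Integration.integral_reflect_real[where a = "-1" and b = 1 and f = g] by simp_all
  \<comment> \<open>Here \<open>t\<close> stands for |x|; either sign of \<open>x\<close> is then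
    covered by the sum \<open>g x + g (- x)\<close>.\<close>
  have key: "\<bar>f x\<bar> \<le> g t" if "0 \<le> t" "t \<le> 1" "t = x \<or> t = - x" for t x
  proof -
    define u where "u = b * (1 - t)"
    have x: "\<bar>x\<bar> \<le> 1" "x\<^sup>2 = t\<^sup>2"
      using that by auto
    have u: "0 \<le> u" "u \<le> b * (1 - x\<^sup>2)"
      using that b mult_left_mono[of t 1 t] by (auto simp: u_def x power2_eq_square)
    have "\<bar>f x\<bar> * u\<^sup>2 \<le> \<bar>f x\<bar> * (b * (1 - x\<^sup>2))\<^sup>2"
      using u by (intro mult_left_mono power_mono) auto
    also have "\<dots> \<le> 1"
      by (rule decay[OF x(1)])
    finally have "\<bar>f x\<bar> * u\<^sup>2 \<le> 1" .
    moreover have "\<bar>f x\<bar> * (1 + u)\<^sup>2 \<le> \<bar>f x\<bar> * (2 + 2 * u\<^sup>2)"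
      using sum_squares_bound[of 1 u] by (intro mult_left_mono) (auto simp: power2_sum)
    ultimately have "\<bar>f x\<bar> * (1 + u)\<^sup>2 \<le> 4"
      using le[OF x(1)] by (simp add: distrib_left)
    moreover have "(1 + u)\<^sup>2 > 0"
      using u by (intro zero_less_power) linarith
    ultimately show ?thesis
      by (simp add: g_def u_def[symmetric] pos_le_divide_eq)
  qed
  have "integral {-1..1} (\<lambda>x. \<bar>f x\<bar>) \<le> integral {-1..1} (\<lambda>x. g x + g (- x))"
  proof (rule integral_le)
    show "\<bar>f x\<bar> \<le> g x + g (- x)" if "x \<in> {-1..1}" for x
      using key[of x x] key[of "- x" x] that g0[of x] g0[of "- x"]
      by (cases "x \<ge> 0") auto
    show "(\<lambda>x. \<bar>f x\<bar>) integrable_on {-1..1}"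
      using cont by (intro integrable_continuous_interval continuous_intros)
    show "(\<lambda>x. g x + g (- x)) integrable_on {-1..1}"
      by (intro integrable_add g g')
  qed
  also have "\<dots> \<le> 8 / b"
    using g g' by (simp add: integral_add)
  finally show ?thesis .
qed

text \<open>A Jackson-type kernel \<open>(sin (a t) / (a sin t))\<^sup>4\<close> in the variable \<open>x = cos t\<close>, multiplied
  by a power of \<open>x\<close> to reach the exact degree.\<close>

lemma peaked_polynomial:
  assumes n: "n > 0"
  obtains Q :: "real poly" and a d :: real
  where "degree Q = n" "a \<ge> 1" "real n \<le> 4 * a" "1 / a\<^sup>2 \<le> d" "d \<le> 2 / a\<^sup>2" "d \<le> 1"
    "poly Q 1 = 1" "poly Q (1 - d) \<le> 1/2"
    "\<And>x. \<bar>x\<bar> \<le> 1 \<Longrightarrow> \<bar>poly Q x\<bar> \<le> 1" "integral {-1..1} (\<lambda>x. \<bar>poly Q x\<bar>) \<le> 8 / a\<^sup>2"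
proof -
  \<comment> \<open>\<open>S\<close> has degree \<open>k\<close> and value \<open>a\<close> at 1, so
    the fourth power of S/a times x^r has degree 4k + r = n and value 1 at 1.\<close>
  define k where "k = n div 4"
  define r where "r = n mod 4"
  define a where "a = real (Suc k)"
  define S where "S = chebS (Suc k)"
  define Q where "Q = smult (1 / a ^ 4) (S ^ 4) * monom 1 r"
  \<comment> \<open>For \<open>k = 0\<close> the polynomial is x^r with r > 0, which vanishes at 1 -
    d = 0. Otherwise a^2 d = 2, and the decay estimate at 1 - d even gives 1/4.\<close>
  define d where "d = (if k = 0 then 1 else 2 / a\<^sup>2)"
  have a: "a \<ge> 1"
    by (simp add: a_def)
  have S0: "S \<noteq> 0"
    using coeff_chebS_pos[of k] by (auto simp: S_def simp del: chebS.simps)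
  have poly_Q: "poly Q x = (poly S x / a) ^ 4 * x ^ r" for x
    by (simp add: Q_def poly_monom power_divide)
  have deg: "degree Q = n"
    using a S0 by (simp add: Q_def degree_mult_eq degree_power_eq degree_monom_eq)
      (simp add: S_def degree_chebS k_def r_def del: chebS.simps)
  have na: "real n \<le> 4 * a"
  proof -
    have "n \<le> 4 * Suc k"
      by (simp add: k_def)
    then show ?thesis
      unfolding a_def by (metis of_nat_le_iff of_nat_mult of_nat_numeral)
  qed
  have abs_Q: "\<bar>poly Q x\<bar> = (\<bar>poly S x\<bar> / a) ^ 4 * \<bar>x\<bar> ^ r" for x
    using a by (simp add: poly_Q abs_mult power_abs)
  have le: "\<bar>poly Q x\<bar> \<le> 1" if "\<bar>x\<bar> \<le> 1" for x
  proof -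
    have "\<bar>poly S x\<bar> / a \<le> 1"
      using abs_chebS_le[OF that, of "Suc k"] a by (simp add: S_def a_def del: chebS.simps)
    then show ?thesis
      unfolding abs_Q using that a by (intro mult_le_one power_le_one) auto
  qed
  have decay: "\<bar>poly Q x\<bar> * (a\<^sup>2 * (1 - x\<^sup>2))\<^sup>2 \<le> 1" if x: "\<bar>x\<bar> \<le> 1" for x
  proof -
    have x2: "x\<^sup>2 \<le> 1"
      using x by (simp add: abs_square_le_1)
    \<comment> \<open>The Pell identity replaces the bound 1/(sin t)^2 for the square of
      \<open>S\<close>.\<close>
    have "(1 - x\<^sup>2) * (poly S x)\<^sup>2 \<le> 1"
      using cheb_pell[of "Suc k" x] unfolding S_def by (smt (verit) zero_le_power2)
    then have "((1 - x\<^sup>2) * (poly S x)\<^sup>2)\<^sup>2 \<le> 1"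
      using x2 by (intro power_le_one) auto
    moreover have "\<bar>poly Q x\<bar> * (a\<^sup>2 * (1 - x\<^sup>2))\<^sup>2 = ((1 - x\<^sup>2) * (poly S x)\<^sup>2)\<^sup>2 * \<bar>x\<bar> ^ r"
      using a by (simp add: abs_Q power_divide power_mult_distrib power4_eq_xxxx power2_eq_square)
    moreover have "\<bar>x\<bar> ^ r \<le> 1"
      using x by (intro power_le_one) auto
    ultimately show ?thesis
      by (simp add: mult_le_one)
  qed
  have d: "1 / a\<^sup>2 \<le> d" "d \<le> 2 / a\<^sup>2" "d \<le> 1" "poly Q (1 - d) \<le> 1/2"
  proof -
    have "1 / a\<^sup>2 \<le> d \<and> d \<le> 2 / a\<^sup>2 \<and> d \<le> 1 \<and> poly Q (1 - d) \<le> 1/2"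
    proof (cases "k = 0")
      case True
      then have "r > 0"
        using n by (simp add: r_def k_def)
      then show ?thesis
        using True by (simp add: d_def a_def poly_Q zero_power)
    next
      case False
      then have a2: "a \<ge> 2"
        by (simp add: a_def)
      then have a4: "a\<^sup>2 \<ge> 4"
        using power_mono[of 2 a 2] by simp
      have dd: "a\<^sup>2 * d = 2" "0 < d" "d \<le> 1"
        using False a2 a4 by (auto simp: d_def)
      have "2 \<le> a\<^sup>2 * (1 - (1 - d)\<^sup>2)"
      proof -
        have "d \<le> 1 - (1 - d)\<^sup>2"
          using dd mult_left_mono[of d 1 d] by (simp add: power2_eq_square algebra_simps)
        then show ?thesis
          using dd(1) mult_left_mono[of d "1 - (1 - d)\<^sup>2" "a\<^sup>2"] by simp
      qed
      then have "\<bar>poly Q (1 - d)\<bar> * 2\<^sup>2 \<le> \<bar>poly Q (1 - d)\<bar> * (a\<^sup>2 * (1 - (1 - d)\<^sup>2))\<^sup>2"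
        by (intro mult_left_mono power_mono) auto
      also have "\<dots> \<le> 1"
        using dd by (intro decay) auto
      finally have "poly Q (1 - d) \<le> 1/2"
        by simp
      then show ?thesis
        using False dd a2 by (auto simp: d_def divide_right_mono)
    qed
    then show "1 / a\<^sup>2 \<le> d" "d \<le> 2 / a\<^sup>2" "d \<le> 1" "poly Q (1 - d) \<le> 1/2"
      by auto
  qed
  have "poly Q 1 = 1"
    using a by (simp add: poly_Q S_def a_def del: chebS.simps)
  moreover have "integral {-1..1} (\<lambda>x. \<bar>poly Q x\<bar>) \<le> 8 / a\<^sup>2"
    using a le decay by (intro integral_abs_le_of_decay continuous_intros) auto
  ultimately show thesis
    using that[of Q a d] deg a na d le by blast
qed

subsection \<open>The Orlicz norm\<close>

lemma nn_integral_mu: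
  assumes cont: "continuous_on {-1..1} g" and nonneg: "\<And>x. 0 \<le> g x"
  shows "(\<integral>\<^sup>+ x. ennreal (g x) \<partial>mu) = ennreal (integral {-1..1} g / 2)"
proof -
  have [measurable]: "g \<in> borel_measurable (lebesgue_on {-1..1})"
    using cont by (intro continuous_imp_measurable_on_sets_lebesgue) auto
  have "(g has_integral integral {-1..1} g) {-1..1}"
    using cont by (simp add: integrable_continuous_interval integrable_integral)
  then have "(\<integral>\<^sup>+ x. ennreal (g x) \<partial>lebesgue_on {-1..1}) = ennreal (integral {-1..1} g)"
    using nonneg nn_integral_has_integral_lebesgue'[of "{-1..1}" g]
    by (simp add: nn_integral_restrict_space nn_integral_completion)
  then have "(\<integral>\<^sup>+ x. ennreal (g x) \<partial>mu) = (1 / 2) * ennreal (integral {-1..1} g)"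
    unfolding mu_def by (subst nn_integral_scale_measure) auto
  also have "(1 / 2 :: ennreal) = ennreal (1 / 2)"
    by (simp add: divide_ennreal flip: ennreal_numeral ennreal_1)
  also have "ennreal (1 / 2) * ennreal (integral {-1..1} g) = ennreal (integral {-1..1} g / 2)"
    by (subst ennreal_mult'[symmetric]) auto
  finally show ?thesis .
qed

lemma even_convex_N_fun:
  assumes "admissible_constants \<phi> C1 C2"
  shows "even_convex (N_fun \<phi> C1 C2)"
  using assms unfolding admissible_constants_def N_Orlicz_function_def
  by unfold_locales auto

context
  fixes \<phi> :: "real \<Rightarrow> real" and C1 C2 :: real
  assumes admissible: "admissible_constants \<phi> C1 C2"
begin

interpretation even_convex "N_fun \<phi> C1 C2"
  by (rule even_convex_N_fun[OF admissible])

lemma N_fun_1_pos: "N_fun \<phi> C1 C2 1 > 0"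
proof -
  have "N_fun \<phi> C1 C2 1 \<noteq> 0"
    using admissible unfolding admissible_constants_def N_Orlicz_function_def by (metis zero_neq_one)
  then show ?thesis
    using nonneg[of 1] by simp
qed

text \<open>The threshold 2 is the length of [-1, 1], undoing the normalization of
  \<open>mu\<close>; evenness of \<open>N_fun\<close> absorbs the absolute value.\<close>

lemma B_norm_eq_INF:
  assumes "continuous_on {-1..1} f"
  shows "B_norm \<phi> C1 C2 f =
    (INF l\<in>{l::real. l > 0 \<and> integral {-1..1} (\<lambda>x. N_fun \<phi> C1 C2 (f x / l)) \<le> 2}. ennreal l)"
proof -
  have "(\<integral>\<^sup>+ x. ennreal (N_fun \<phi> C1 C2 (\<bar>f x\<bar> / l)) \<partial>mu)
      = ennreal (integral {-1..1} (\<lambda>x. N_fun \<phi> C1 C2 (f x / l)) / 2)" if "l > 0" for l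
  proof -
    have "N_fun \<phi> C1 C2 (\<bar>f x\<bar> / l) = N_fun \<phi> C1 C2 (f x / l)" for x
      using N_abs[of "f x / l"] that by (simp add: abs_divide)
    then show ?thesis
      using assms that by (simp add: nn_integral_mu nonneg continuous_intros)
  qed
  then show ?thesis
    unfolding B_norm_def
    by (intro arg_cong[where f = "\<lambda>A. INF l\<in>A. ennreal l"]) (auto simp: ennreal_le_1)
qed

text \<open>Multiplication by \<open>c\<close> carries every scale admissible for \<open>f\<close>
  to one admissible for \<open>g\<close>. If \<open>f\<close> has no admissible scale, its norm is
  infinite and the bound is trivial.\<close>

lemma B_norm_le_mult:
  assumes "continuous_on {-1..1} f" "continuous_on {-1..1} g" and c: "c > 0"
    and le: "\<And>l. l > 0 \<Longrightarrow> integral {-1..1} (\<lambda>x. N_fun \<phi> C1 C2 (f x / l)) \<le> 2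
      \<Longrightarrow> integral {-1..1} (\<lambda>x. N_fun \<phi> C1 C2 (g x / (c * l))) \<le> 2"
  shows "B_norm \<phi> C1 C2 g \<le> ennreal c * B_norm \<phi> C1 C2 f"
proof -
  have "ennreal (1 / c) * B_norm \<phi> C1 C2 g \<le> B_norm \<phi> C1 C2 f"
    unfolding B_norm_eq_INF[OF assms(1)]
  proof (rule INF_greatest)
    fix l assume "l \<in> {l. l > 0 \<and> integral {-1..1} (\<lambda>x. N_fun \<phi> C1 C2 (f x / l)) \<le> 2}"
    then have l: "l > 0" "integral {-1..1} (\<lambda>x. N_fun \<phi> C1 C2 (g x / (c * l))) \<le> 2"
      using le by auto
    then have "B_norm \<phi> C1 C2 g \<le> ennreal (c * l)"
      unfolding B_norm_eq_INF[OF assms(2)] using c by (intro INF_lower) auto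
    then have "ennreal (1 / c) * B_norm \<phi> C1 C2 g \<le> ennreal (1 / c) * ennreal (c * l)"
      by (intro mult_left_mono) auto
    also have "\<dots> = ennreal l"
      using c l by (subst ennreal_mult[symmetric]) auto
    finally show "ennreal (1 / c) * B_norm \<phi> C1 C2 g \<le> ennreal l" .
  qed
  then have "ennreal c * (ennreal (1 / c) * B_norm \<phi> C1 C2 g) \<le> ennreal c * B_norm \<phi> C1 C2 f"
    by (intro mult_left_mono) auto
  moreover have "ennreal c * (ennreal (1 / c) * B_norm \<phi> C1 C2 g) = B_norm \<phi> C1 C2 g"
    using c by (subst mult.assoc[symmetric], subst ennreal_mult[symmetric]) auto
  ultimately show ?thesis
    by simp
qed

lemma markov_B_norm:
  assumes "n > 0" "degree Q = n"
  shows "B_norm \<phi> C1 C2 (poly (pderiv Q)) \<le> ennreal (4 * (real n)\<^sup>2) * B_norm \<phi> C1 C2 (poly Q)"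
proof (rule B_norm_le_mult)
  fix l :: real
  assume l: "l > 0" and le: "integral {-1..1} (\<lambda>x. N_fun \<phi> C1 C2 (poly Q x / l)) \<le> 2"
  have "integral {-1..1} (\<lambda>x. N_fun \<phi> C1 C2 (poly (pderiv (smult (1 / l) Q)) x / (4 * (real n)\<^sup>2)))
      \<le> integral {-1..1} (\<lambda>x. N_fun \<phi> C1 C2 (poly (smult (1 / l) Q) x))"
    using assms by (intro markov_modular) (auto intro: order_trans[OF degree_smult_le])
  also have "\<dots> \<le> 2"
    using le by simp
  finally show "integral {-1..1} (\<lambda>x. N_fun \<phi> C1 C2 (poly (pderiv Q) x / (4 * (real n)\<^sup>2 * l))) \<le> 2"
    by (simp add: pderiv_smult mult_ac)
qed (use assms in \<open>auto intro!: continuous_intros\<close>)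

text \<open>Finiteness makes the norm cancel in the quotient defining \<open>W\<close>.\<close>

lemma B_norm_less_top:
  assumes le: "\<And>x. \<bar>x\<bar> \<le> 1 \<Longrightarrow> \<bar>poly Q x\<bar> \<le> 1"
  shows "B_norm \<phi> C1 C2 (poly Q) < top"
proof -
  define l where "l = max 1 (N_fun \<phi> C1 C2 1)"
  have l: "l \<ge> 1" "N_fun \<phi> C1 C2 1 \<le> l"
    by (auto simp: l_def)
  have "N_fun \<phi> C1 C2 (poly Q x / l) \<le> 1" if "x \<in> {-1..1}" for x
  proof -
    have "N_fun \<phi> C1 C2 (poly Q x / l) \<le> N_fun \<phi> C1 C2 (1 / l * 1)"
      using le[of x] that l by (intro N_mono) (auto intro: divide_right_mono)
    also have "\<dots> \<le> 1 / l * N_fun \<phi> C1 C2 1"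
      using l by (intro N_scale_le) auto
    also have "\<dots> \<le> 1"
      using l by simp
    finally show ?thesis .
  qed
  moreover have "continuous_on {-1..1} (\<lambda>x. N_fun \<phi> C1 C2 (poly Q x / l))"
    using l by (intro continuous_intros) auto
  ultimately have "integral {-1..1} (\<lambda>x. N_fun \<phi> C1 C2 (poly Q x / l)) \<le> integral {-1..1} (\<lambda>x::real. 1)"
    by (intro integral_le integrable_continuous_interval continuous_on_const)
  then have "B_norm \<phi> C1 C2 (poly Q) \<le> ennreal l"
    using l by (subst B_norm_eq_INF) (auto intro!: continuous_intros INF_lower)
  then show ?thesis
    using ennreal_less_top le_less_trans by blast
qed

lemma W_upper: "W \<phi> C1 C2 n \<le> ennreal (4 * (real n)\<^sup>2)"
  unfolding W_def
proof (rule SUP_least)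
  fix Q :: "real poly" assume "Q \<in> {Q. Q \<noteq> 0 \<and> degree Q = n}"
  then have deg: "degree Q = n"
    by simp
  have "B_norm \<phi> C1 C2 (poly (pderiv Q)) \<le> ennreal (4 * (real n)\<^sup>2) * B_norm \<phi> C1 C2 (poly Q)"
  \<comment> \<open>For constants the derivative is 0 and every positive scale is admissible, so its
    norm is 0.\<close>
  proof (cases "n = 0")
    case True
    then have Q': "pderiv Q = 0"
      using deg by (simp add: pderiv_eq_0_iff)
    have "B_norm \<phi> C1 C2 (poly (pderiv Q)) \<le> ennreal e" if "e > 0" for e
      using that by (subst B_norm_eq_INF) (auto simp: Q' zero intro!: INF_lower)
    then have "B_norm \<phi> C1 C2 (poly (pderiv Q)) \<le> 0"
      using ennreal_le_epsilon[of 0 "B_norm \<phi> C1 C2 (poly (pderiv Q))"] by simp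
    then show ?thesis
      by simp
  qed (use deg markov_B_norm in auto)
  then have "B_norm \<phi> C1 C2 (poly (pderiv Q)) / B_norm \<phi> C1 C2 (poly Q)
      \<le> ennreal (4 * (real n)\<^sup>2) * (B_norm \<phi> C1 C2 (poly Q) / B_norm \<phi> C1 C2 (poly Q))"
    unfolding ennreal_times_divide by (rule divide_right_mono_ennreal)
  \<comment> \<open>In \<open>ennreal\<close> the quotient of a norm by itself is 1, or 0 when the
    norm is 0 or infinite.\<close>
  also have "\<dots> \<le> ennreal (4 * (real n)\<^sup>2) * 1"
    by (intro mult_left_mono)
      (metis ennreal_divide_self ennreal_divide_top ennreal_zero_divide order_refl top.not_eq_extremum zero_le_one, simp)
  finally show "B_norm \<phi> C1 C2 (poly (pderiv Q)) / B_norm \<phi> C1 C2 (poly Q) \<le> ennreal (4 * (real n)\<^sup>2)"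
    by simp
qed

text \<open>One peaked polynomial suffices for each positive degree, and the constant is absolute:
  1024 = 64 * 16, where 64 compares the two norms and 16 comes from n <= 4a.\<close>

lemma W_lower: "ennreal (1 / 1024 * (real n)\<^sup>2) \<le> W \<phi> C1 C2 n"
proof (cases "n = 0")
  case False
  then have n: "n > 0"
    by simp
  obtain Q :: "real poly" and a d :: real
    where Q: "degree Q = n" "a \<ge> 1" "real n \<le> 4 * a" "1 / a\<^sup>2 \<le> d" "d \<le> 2 / a\<^sup>2" "d \<le> 1"
      "poly Q 1 = 1" "poly Q (1 - d) \<le> 1/2"
      "\<And>x. \<bar>x\<bar> \<le> 1 \<Longrightarrow> \<bar>poly Q x\<bar> \<le> 1" "integral {-1..1} (\<lambda>x. \<bar>poly Q x\<bar>) \<le> 8 / a\<^sup>2"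
    by (rule peaked_polynomial[OF n]) (rule that)
  let ?A = "B_norm \<phi> C1 C2 (poly (pderiv Q))" and ?B = "B_norm \<phi> C1 C2 (poly Q)"
  have steep: "N_fun \<phi> C1 C2 (a\<^sup>2 / (8 * l)) \<le> 2 * a\<^sup>2"
    if "l > 0" "integral {-1..1} (\<lambda>x. N_fun \<phi> C1 C2 (poly (pderiv Q) x / l)) \<le> 2" for l
    using N_le_of_steep[OF Q(2,4-6) that(1) Q(7,8) that(2)] .
  have BA: "?B \<le> ennreal (64 / a\<^sup>2) * ?A"
  proof (rule B_norm_le_mult)
    fix l :: real
    assume l: "l > 0" "integral {-1..1} (\<lambda>x. N_fun \<phi> C1 C2 (poly (pderiv Q) x / l)) \<le> 2"
    show "integral {-1..1} (\<lambda>x. N_fun \<phi> C1 C2 (poly Q x / (64 / a\<^sup>2 * l))) \<le> 2"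
      using modular_le_of_concentrated[OF Q(2) l(1) steep[OF l] Q(9,10)] by simp
  qed (use Q(2) in \<open>auto intro!: continuous_intros\<close>)
  \<comment> \<open>A positive lower bound for all scales admissible for Q', obtained by solving the
    affine minorant of \<open>N_fun\<close> at 1 for \<open>l\<close>.\<close>
  define m where "m = a\<^sup>2 / 8 / (1 + 2 * a\<^sup>2 / N_fun \<phi> C1 C2 1)"
  have pos: "1 + 2 * a\<^sup>2 / N_fun \<phi> C1 C2 1 > 0"
    using N_fun_1_pos by (intro add_pos_nonneg) auto
  then have m: "m > 0"
    using Q(2) by (simp add: m_def)
  have "ennreal m \<le> ?A"
  proof (subst B_norm_eq_INF)
    show "ennreal m \<le> (INF l\<in>{l. l > 0 \<and> integral {-1..1} (\<lambda>x. N_fun \<phi> C1 C2 (poly (pderiv Q) x / l)) \<le> 2}. ennreal l)"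
    proof (rule INF_greatest)
      fix l assume "l \<in> {l. l > 0 \<and> integral {-1..1} (\<lambda>x. N_fun \<phi> C1 C2 (poly (pderiv Q) x / l)) \<le> 2}"
      then have l: "l > 0" and "N_fun \<phi> C1 C2 (a\<^sup>2 / (8 * l)) \<le> 2 * a\<^sup>2"
        using steep by auto
      then have "N_fun \<phi> C1 C2 1 * (a\<^sup>2 / (8 * l) - 1) \<le> 2 * a\<^sup>2"
        using N_ge_linear[of 1 "a\<^sup>2 / (8 * l)"] by simp
      then have "a\<^sup>2 / (8 * l) \<le> 1 + 2 * a\<^sup>2 / N_fun \<phi> C1 C2 1"
        using N_fun_1_pos by (simp add: field_simps)
      then have "a\<^sup>2 / 8 \<le> l * (1 + 2 * a\<^sup>2 / N_fun \<phi> C1 C2 1)"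
        using l by (simp add: field_simps)
      then have "m \<le> l"
        using pos unfolding m_def by (subst pos_divide_le_eq)
      then show "ennreal m \<le> ennreal l"
        by (rule ennreal_leI)
    qed
  qed (auto intro!: continuous_intros)
  then have "?A \<noteq> 0"
    using m by auto
  \<comment> \<open>By the Markov inequality a vanishing norm of \<open>Q\<close> would force that
    of Q' to vanish.\<close>
  then have B0: "?B \<noteq> 0"
    using markov_B_norm[OF n Q(1)] by auto
  have Btop: "?B < top"
    by (rule B_norm_less_top[OF Q(9)])
  have "1 / 1024 * (real n)\<^sup>2 \<le> a\<^sup>2 / 64"
    using power_mono[OF Q(3), of 2] by (simp add: power_mult_distrib)
  then have "ennreal (1 / 1024 * (real n)\<^sup>2) \<le> ennreal (a\<^sup>2 / 64)"
    by (rule ennreal_leI)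
  also have "\<dots> = ennreal (a\<^sup>2 / 64) * ?B / ?B"
    using B0 Btop by (simp flip: ennreal_times_divide)
  also have "\<dots> \<le> ennreal (a\<^sup>2 / 64) * (ennreal (64 / a\<^sup>2) * ?A) / ?B"
    using BA by (intro divide_right_mono_ennreal mult_left_mono) auto
  also have "ennreal (a\<^sup>2 / 64) * (ennreal (64 / a\<^sup>2) * ?A) = ?A"
    using Q(2) by (subst mult.assoc[symmetric], subst ennreal_mult[symmetric]) auto
  also have "?A / ?B \<le> W \<phi> C1 C2 n"
    unfolding W_def using Q(1) n by (intro SUP_upper) auto
  finally show ?thesis .
qed simp

end

subsection \<open>The constants\<close>

text \<open>Both t + 1 and x are convex combinations of t and x + 1, with complementary weights; the
  two convexity inequalities are added.\<close>

lemma convex_on_increment_mono: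
  fixes h :: "real \<Rightarrow> real"
  assumes h: "convex_on UNIV h" and "t \<le> x"
  shows "h (t + 1) - h t \<le> h (x + 1) - h x"
proof -
  define \<theta> where "\<theta> = 1 / (x + 1 - t)"
  have \<theta>: "0 \<le> \<theta>" "\<theta> \<le> 1" "\<theta> * (x + 1 - t) = 1"
    using assms by (auto simp: \<theta>_def)
  have "t + 1 = (1 - \<theta>) * t + \<theta> * (x + 1)" "x = (1 - (1 - \<theta>)) * t + (1 - \<theta>) * (x + 1)"
    using \<theta>(3) by (simp_all add: algebra_simps)
  then have "h (t + 1) \<le> (1 - \<theta>) * h t + \<theta> * h (x + 1)" "h x \<le> \<theta> * h t + (1 - \<theta>) * h (x + 1)"
    using convex_onD[OF h, of \<theta> t "x + 1"] convex_onD[OF h, of "1 - \<theta>" t "x + 1"] \<theta> by simp_all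
  then show ?thesis
    by (simp add: algebra_simps)
qed

lemma C4_ge:
  assumes \<phi>: "\<phi> \<in> class_Phi" and C1: "C1 > 0"
  shows "C4 \<phi> C1 C2 \<ge> 4"
proof -
  let ?k = "k0 \<phi> C1" and ?h = "h_fun \<phi>"
  have k: "?k \<ge> 5" "?k \<ge> 4 + ln C1"
    by (auto simp: k0_def)
  have conv: "convex_on UNIV ?h" and pos: "\<And>z. z \<ge> 0 \<Longrightarrow> \<phi> z \<ge> 0"
    and summ: "summable (\<lambda>j::nat. exp (?h (real (j + 3)) - ?h (real (j + 3) + 1)))"
    using \<phi> unfolding class_Phi_def by auto
  have "summable (\<lambda>j::nat. exp (?h (?k + real j - 1) - ?h (?k + real j)))"
  proof (rule summable_comparison_test'[OF summ])
    fix j :: nat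
    show "norm (exp (?h (?k + real j - 1) - ?h (?k + real j)))
        \<le> exp (?h (real (j + 3)) - ?h (real (j + 3) + 1))"
      using convex_on_increment_mono[OF conv, of "real (j + 3)" "?k + real j - 1"] k by simp
  qed
  then have tail: "(\<Sum>j::nat. exp (?h (?k + real j - 1) - ?h (?k + real j))) \<ge> 0"
    by (intro suminf_nonneg) auto
  have "exp (?k - 2) > exp (ln C1)"
    using k by simp
  then have "exp (?k - 2) > C1"
    using C1 by simp
  then have "N_fun \<phi> C1 C2 (exp (?k - 2)) \<ge> 1"
    using pos[of "exp (?k - 2)"] by (simp add: N_fun_def)
  moreover have "exp (2::real) \<ge> 4"
    using power_mono[of 2 "exp (1::real)" 2] exp_ge_add_one_self[of 1] by (simp flip: exp_of_nat_mult)
  ultimately have "exp 2 * (N_fun \<phi> C1 C2 (exp (?k - 2)) +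
      (\<Sum>j::nat. exp (?h (?k + real j - 1) - ?h (?k + real j)))) \<ge> 4 * 1"
    using tail by (intro mult_mono) auto
  then show ?thesis
    by (simp add: C4_def)
qed

lemma K4_ge_1: "K4 \<ge> 1"
  unfolding K4_def using pi_gt3 by (intro ge_one_powr_ge_zero) auto

theorem theorem1:
  fixes \<phi> :: "real \<Rightarrow> real" and C1 C2 :: real
  assumes "\<phi> \<in> class_Phi" and "admissible_constants \<phi> C1 C2"
  shows "\<exists>C5>0. \<forall>n::nat.
           ennreal (C5 * real n ^ 2) \<le> W \<phi> C1 C2 n \<and>
           W \<phi> C1 C2 n \<le> ennreal (real n ^ 2 * K4 * max 1 (psi \<phi> 4) * C4 \<phi> C1 C2 * C3 C1 C2)"
proof (intro exI[of _ "1 / 1024"] conjI allI)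
  fix n :: nat
  show "ennreal (1 / 1024 * real n ^ 2) \<le> W \<phi> C1 C2 n"
    by (rule W_lower[OF assms(2)])
  have C4: "C4 \<phi> C1 C2 \<ge> 4"
    using assms by (intro C4_ge) (auto simp: admissible_constants_def)
  have C3: "C3 C1 C2 \<ge> 1"
    by (simp add: C3_def)
  have "K4 * max 1 (psi \<phi> 4) \<ge> 1 * 1"
    using K4_ge_1 by (intro mult_mono) auto
  then have "(K4 * max 1 (psi \<phi> 4)) * C4 \<phi> C1 C2 \<ge> 1 * 4"
    using C4 by (intro mult_mono) auto
  then have "(K4 * max 1 (psi \<phi> 4)) * C4 \<phi> C1 C2 * C3 C1 C2 \<ge> 4 * 1"
    using C3 by (intro mult_mono) auto
  then have "real n ^ 2 * 4 \<le> real n ^ 2 * ((K4 * max 1 (psi \<phi> 4)) * C4 \<phi> C1 C2 * C3 C1 C2)"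
    by (intro mult_left_mono) auto
  then have "ennreal (4 * (real n)\<^sup>2)
      \<le> ennreal (real n ^ 2 * K4 * max 1 (psi \<phi> 4) * C4 \<phi> C1 C2 * C3 C1 C2)"
    by (intro ennreal_leI) (simp add: mult_ac)
  with W_upper[OF assms(2)] show
    "W \<phi> C1 C2 n \<le> ennreal (real n ^ 2 * K4 * max 1 (psi \<phi> 4) * C4 \<phi> C1 C2 * C3 C1 C2)"
    by (rule order_trans)
qed simp

end
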